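(* Let $u:[t_0,T[\to\mathcal H$ be a solution of (IMOG) with initial data $u(t_0)=u_0\in\mathcal H$ and $\dot u(t_0)=\dot u_0\in\mathcal H$, and suppose that for some $i\in\{1,\dots,q\}$, $$\gamma^2 > mL_i, \quad \text{where } L_i:=\mathrm{Lip}(\nabla f_i;u([t_0,T[)).$$ If $\dot u_0$ satisfies $$\langle \nabla f_i (u_0) , \dot u_0 \rangle \leq - \gamma \Vert \dot u_0 \Vert^2, \qquad ( * )$$ then $f_i(u(t)) \leq f_i(u_0)$ for all $t \in [t_0,T[$. In particular, for all $\lambda \in [0,\frac{1}{\gamma}]$, the vector $\dot u_0=\lambda s(u_0)$ satisfies $( * )$.
   Context: $\mathcal H$ is a real Hilbert space, $q\ge 1$ is an integer, and $f_i : \mathcal H \to \mathbb R$ ($i\in\{1,\dots,q\}$) are continuously differentiable functions whose gradients $\nabla f_i$ are Lipschitz continuous on bounded sets. $m>0$ and $\gamma>0$ are fixed real parameters. For $u\in\mathcal H$, let $\mathrm{co}\,\nabla f_i(u)$ denote the convex hull of $\{\nabla f_1(u),\dots,\nabla f_q(u)\}$. The vector field $s:\mathcal H\to\mathcal H$ is defined by letting $-s(u)$ be the element of minimal norm of $\mathrm{co}\,\nabla f_i(u)$. Given $t_0\in\mathbb R$, $T\in\,]t_0,+\infty]$ and $(u_0,\dot u_0)\in\mathcal H^2$, a solution (trajectory) of (IMOG) on $[t_0,T[$ is a function $u:[t_0,T[\to\mathcal H$ which is continuous on $[t_0,T[$, of class $C^2$ on $]t_0,T[$, and satisfies $$m\ddot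 u(t) = -\gamma\dot u(t)+s(u(t)) \text{ for all } t\in\,]t_0,T[,\qquad u(t_0)=u_0,\ \dot u(t_0)=\dot u_0$$ (derivatives at $t_0$ being right derivatives). For $\phi:\mathcal H\to\mathcal H$ and a nonempty $A\subset\mathcal H$, $\mathrm{Lip}(\phi;A):=\sup_{x\ne y\in A}\frac{\|\phi(x)-\phi(y)\|}{\|x-y\|}\in[0,+\infty]$. *)

theory Defs
  imports "HOL-Analysis.Analysis"
begin

text \<open>
  Real Hilbert spaces are rendered by the sort \<open>{real_inner, complete_space}\<close>; no dimension or
  separability assumption is made.
\<close>

definition grad :: "('a::real_inner \<Rightarrow> real) \<Rightarrow> 'a \<Rightarrow> 'a" where
  "grad f x = (THE D. GDERIV f x :> D)"

text \<open>
  Continuity of the derivative, as a map into the dual space, is expressed through the gradient: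
  the two agree because the Riesz isomorphism is isometric.
\<close>

definition cont_diff :: "('a::real_inner \<Rightarrow> real) \<Rightarrow> bool" where
  "cont_diff f \<longleftrightarrow> (\<forall>x. f differentiable (at x)) \<and> continuous_on UNIV (grad f)"

definition lipschitz_on_bounded_sets ::
    "('a::metric_space \<Rightarrow> 'b::metric_space) \<Rightarrow> bool" where
  "lipschitz_on_bounded_sets \<phi> \<longleftrightarrow> (\<forall>B. bounded B \<longrightarrow> (\<exists>L. L-lipschitz_on B \<phi>))"

text \<open>
  In \<^typ>\<open>ennreal\<close> the empty supremum is \<open>0\<close>, so the constant of a singleton is \<open>0\<close>.
\<close>

definition Lip :: "('a::real_normed_vector \<Rightarrow> 'b::real_normed_vector) \<Rightarrow> 'a set \<Rightarrow> ennreal" where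
  "Lip \<phi> A = (SUP (x, y) \<in> {(x, y). x \<in> A \<and> y \<in> A \<and> x \<noteq> y}.
     ennreal (norm (\<phi> x - \<phi> y) / norm (x - y)))"

definition grad_hull :: "nat \<Rightarrow> (nat \<Rightarrow> 'a::real_inner \<Rightarrow> real) \<Rightarrow> 'a \<Rightarrow> 'a set" where
  "grad_hull q f u = convex hull ((\<lambda>i. grad (f i) u) ` {1..q})"

definition min_norm_element :: "'a::real_inner set \<Rightarrow> 'a" where
  "min_norm_element C = (THE v. v \<in> C \<and> (\<forall>w\<in>C. norm v \<le> norm w))"

definition steepest :: "nat \<Rightarrow> (nat \<Rightarrow> 'a::real_inner \<Rightarrow> real) \<Rightarrow> 'a \<Rightarrow> 'a" where
  "steepest q f u = - min_norm_element (grad_hull q f u)"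

text \<open>\<open>T\<close> may be \<open>\<infinity>\<close>.\<close>

definition time_dom :: "real \<Rightarrow> ereal \<Rightarrow> real set" where
  "time_dom t0 T = {t. t0 \<le> t \<and> ereal t < T}"

text \<open>
  \<open>v\<close> and \<open>a\<close> are the first and second derivatives of \<open>u\<close> on the open interval. Only the values
  of \<open>u\<close> on \<^term>\<open>time_dom t0 T\<close> matter.
\<close>

definition IMOG_solution ::
    "real \<Rightarrow> real \<Rightarrow> nat \<Rightarrow> (nat \<Rightarrow> 'a::real_inner \<Rightarrow> real) \<Rightarrow> real \<Rightarrow> ereal \<Rightarrow>
      'a \<Rightarrow> 'a \<Rightarrow> (real \<Rightarrow> 'a) \<Rightarrow> bool" where
  "IMOG_solution m \<gamma> q f t0 T u0 w0 u \<longleftrightarrow>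
     ereal t0 < T \<and>
     continuous_on (time_dom t0 T) u \<and>
     (\<exists>v a.
        (\<forall>t\<in>time_dom t0 T - {t0}. (u has_vector_derivative v t) (at t)) \<and>
        (\<forall>t\<in>time_dom t0 T - {t0}. (v has_vector_derivative a t) (at t)) \<and>
        continuous_on (time_dom t0 T - {t0}) a \<and>
        (\<forall>t\<in>time_dom t0 T - {t0}.
           m *\<^sub>R a t = - (\<gamma> *\<^sub>R v t) + steepest q f (u t))) \<and>
     u t0 = u0 \<and>
     (u has_vector_derivative w0) (at_right t0)"

lemma GDERIV_unique:
  assumes "GDERIV f x :> D" "GDERIV f x :> E"
  shows "D = E"
proof -
  have "(\<lambda>h. inner h D) = (\<lambda>h. inner h E)"
    using assms unfolding gderiv_def by (rule has_derivative_unique)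
  then have "inner (D - E) D = inner (D - E) E"
    by meson
  then have "inner (D - E) (D - E) = 0"
    by (simp add: inner_diff_right)
  then show ?thesis
    by simp
qed

lemma riesz_representation:
  fixes l :: "'a::{real_inner, complete_space} \<Rightarrow> real"
  assumes "bounded_linear l"
  shows "\<exists>D. \<forall>h. l h = inner h D"
proof -
  interpret l: bounded_linear l by fact
  define \<phi> where "\<phi> x = inner x x / 2 - l x" for x
  obtain K where K: "\<And>x. norm (l x) \<le> norm x * K"
    using l.bounded by blast
  have "- (K\<^sup>2 / 2) \<le> \<phi> x" for x
  proof -
    have "0 \<le> (norm x - K)\<^sup>2" by simp
    moreover have "l x \<le> norm x * K" using K[of x] by simp
    ultimately show ?thesis
      by (simp add: \<phi>_def power2_norm_eq_inner[symmetric] power2_diff)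
  qed
  then have bdd: "bdd_below (range \<phi>)" unfolding bdd_below_def by blast
  define d where "d = Inf (range \<phi>)"
  have d_le: "d \<le> \<phi> x" for x
    unfolding d_def using bdd by (simp add: cInf_lower)
  have "\<exists>x. \<phi> x < d + 1 / (real n + 1)" for n
    using cInf_lessD[of "range \<phi>" "d + 1 / (real n + 1)"] by (auto simp: d_def)
  then obtain X where X: "\<And>n. \<phi> (X n) < d + 1 / (real n + 1)" by metis
  have mid: "(dist x y)\<^sup>2 \<le> 4 * (\<phi> x + \<phi> y - 2 * d)" for x y
  proof -
    have "(dist x y)\<^sup>2 = 4 * (\<phi> x + \<phi> y - 2 * \<phi> ((1/2) *\<^sub>R (x + y)))"
      by (simp add: \<phi>_def dist_norm power2_norm_eq_inner inner_diff inner_add l.add l.scaleR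
          inner_commute field_simps)
    then show ?thesis using d_le[of "(1/2) *\<^sub>R (x + y)"] by simp
  qed
  have "Cauchy X"
  proof (rule metric_CauchyI)
    fix e :: real assume "0 < e"
    then obtain M where M: "1 / (real M + 1) < e\<^sup>2 / 8"
      using reals_Archimedean[of "e\<^sup>2 / 8"] by (auto simp: inverse_eq_divide add.commute)
    have "dist (X i) (X j) < e" if "i \<ge> M" "j \<ge> M" for i j
    proof -
      have "1 / (real i + 1) \<le> 1 / (real M + 1)" "1 / (real j + 1) \<le> 1 / (real M + 1)"
        using that by (simp_all add: frac_le)
      then have "(dist (X i) (X j))\<^sup>2 < e\<^sup>2"
        using M X[of i] X[of j] mid[of "X i" "X j"] by argo
      then show ?thesis using \<open>0 < e\<close> by (simp add: power_less_imp_less_base)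
    qed
    then show "\<exists>M. \<forall>m\<ge>M. \<forall>n\<ge>M. dist (X m) (X n) < e" by blast
  qed
  then obtain z where z: "X \<longlonglongrightarrow> z" by (meson Cauchy_convergent convergentD)
  have "(\<lambda>n. \<phi> (X n)) \<longlonglongrightarrow> \<phi> z"
    unfolding \<phi>_def by (intro tendsto_intros l.tendsto z) simp
  moreover have "(\<lambda>n. d + 1 / (real n + 1)) \<longlonglongrightarrow> d + 0"
    using LIMSEQ_inverse_real_of_nat
    by (intro tendsto_intros) (simp add: inverse_eq_divide add.commute)
  ultimately have "\<phi> z \<le> d + 0"
    by (rule LIMSEQ_le) (use X less_imp_le in blast)
  then have min: "\<phi> z \<le> \<phi> x" for x using d_le[of x] by simp
  have "l h = inner h z" for h
  proof (cases "h = 0")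
    case False
    define c where "c = inner h z - l h"
    define t where "t = - c / inner h h"
    have pos: "inner h h > 0" using False by simp
    have "\<phi> (z + t *\<^sub>R h) = \<phi> z + t * c + t\<^sup>2 * inner h h / 2"
      by (simp add: \<phi>_def c_def l.add l.scaleR inner_add inner_commute power2_eq_square
          field_simps)
    then have "0 \<le> t * c + t\<^sup>2 * inner h h / 2"
      using min[of "z + t *\<^sub>R h"] by simp
    also have "\<dots> = - c\<^sup>2 / (2 * inner h h)"
      using pos by (simp add: t_def power2_eq_square field_simps)
    finally have "c\<^sup>2 \<le> 0" using pos by (simp add: field_simps)
    then show ?thesis by (simp add: c_def)
  qed (simp add: l.zero)
  then show ?thesis by blast
qed

lemma GDERIV_grad:
  fixes f :: "'a::{real_inner, complete_space} \<Rightarrow> real"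
  assumes "f differentiable (at x)"
  shows "GDERIV f x :> grad f x"
proof -
  obtain l where l: "(f has_derivative l) (at x)"
    using assms by (auto simp: differentiable_def)
  obtain D where "\<forall>h. l h = inner h D"
    using riesz_representation[OF has_derivative_bounded_linear[OF l]] by blast
  then have "l = (\<lambda>h. inner h D)" by auto
  then have "GDERIV f x :> D" using l by (simp add: gderiv_def)
  then show ?thesis
    unfolding grad_def by (rule theI) (metis GDERIV_unique \<open>GDERIV f x :> D\<close>)
qed

lemma min_norm_element:
  fixes C :: "'a::real_inner set"
  assumes "compact C" "convex C" "C \<noteq> {}"
  shows "min_norm_element C \<in> C" "\<And>w. w \<in> C \<Longrightarrow> norm (min_norm_element C) \<le> norm w"
proof -
  obtain v where v: "v \<in> C" "\<forall>w\<in>C. norm v \<le> norm w"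
    using continuous_attains_inf[OF assms(1,3), of norm] continuous_on_norm_id by blast
  have "x = v" if x: "x \<in> C" "\<forall>w\<in>C. norm x \<le> norm w" for x
  proof -
    have eq: "norm x = norm v" using v x by (meson antisym)
    have "(1/2) *\<^sub>R x + (1/2) *\<^sub>R v \<in> C"
      using assms(2) v x by (auto intro: convexD)
    then have "norm v \<le> norm ((1/2) *\<^sub>R x + (1/2) *\<^sub>R v)" using v by blast
    then have "(norm v)\<^sup>2 \<le> (norm ((1/2) *\<^sub>R x + (1/2) *\<^sub>R v))\<^sup>2"
      by (simp add: power_mono)
    moreover have "inner x x = inner v v" using eq by (simp add: norm_eq)
    ultimately have "inner (x - v) (x - v) \<le> 0"
      by (simp add: power2_norm_eq_inner inner_add inner_diff inner_commute)
    then have "x - v = 0" using inner_gt_zero_iff[of "x - v"] by argo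
    then show ?thesis by simp
  qed
  then have "\<exists>!v. v \<in> C \<and> (\<forall>w\<in>C. norm v \<le> norm w)" using v by blast
  from theI'[OF this]
  show "min_norm_element C \<in> C" "\<And>w. w \<in> C \<Longrightarrow> norm (min_norm_element C) \<le> norm w"
    unfolding min_norm_element_def by blast+
qed

lemma steepest_well_defined:
  assumes "q \<ge> 1"
  shows "- steepest q f u \<in> grad_hull q f u"
    and "\<And>w. w \<in> grad_hull q f u \<Longrightarrow> norm (steepest q f u) \<le> norm w"
proof -
  have "compact (grad_hull q f u)" "convex (grad_hull q f u)" "grad_hull q f u \<noteq> {}"
    using assms by (auto simp: grad_hull_def finite_imp_compact_convex_hull)
  from min_norm_element[OF this]
  show "- steepest q f u \<in> grad_hull q f u"
    and "\<And>w. w \<in> grad_hull q f u \<Longrightarrow> norm (steepest q f u) \<le> norm w"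
    by (auto simp: steepest_def)
qed

end

theory Submission
  imports Defs
begin

text \<open>
  Write \<open>F = f\<^sub>i \<circ> u\<close>, \<open>v = u'\<close>, \<open>a = v'\<close> and \<open>s = m a + \<gamma> v\<close> for the steepest descent vector along
  the trajectory. Since \<open>-s\<close> is the projection of \<open>0\<close> onto the convex hull of the gradients, the
  variational inequality of the projection gives \<open>\<langle>\<nabla>f\<^sub>i(u), s\<rangle> \<le> - \<parallel>s\<parallel>\<^sup>2\<close>
  (\<open>inner_grad_steepest_le\<close>). This settles the statement about \<open>c s(u\<^sub>0)\<close>, because
  \<open>0 \<le> c \<le> 1/\<gamma>\<close> gives \<open>c \<ge> \<gamma> c\<^sup>2\<close>.

  For the descent, suppose first that \<open>\<nabla>f\<^sub>i \<circ> u\<close> is differentiable. Its derivative has norm at most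
  \<open>L \<parallel>v\<parallel>\<close>, so
  \<open>m F'' + \<gamma> F' \<le> m L \<parallel>v\<parallel>\<^sup>2 + \<langle>\<nabla>f\<^sub>i(u), s\<rangle> \<le> m L \<parallel>v\<parallel>\<^sup>2 - \<parallel>m a + \<gamma> v\<parallel>\<^sup>2\<close>.
  The cross term \<open>- 2 m \<gamma> \<langle>a, v\<rangle>\<close> of the last square is the derivative of \<open>- m \<gamma> \<parallel>v\<parallel>\<^sup>2\<close>.
  Moving it to the left leaves \<open>(m L - \<gamma>\<^sup>2) \<parallel>v\<parallel>\<^sup>2 - m\<^sup>2 \<parallel>a\<parallel>\<^sup>2 \<le> 0\<close> on the right, so the energy
  \<open>E = F' + (\<gamma>/m) F + \<gamma> \<parallel>v\<parallel>\<^sup>2\<close> is nonincreasing. The condition on the initial velocity says exactly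
  that \<open>E\<close> starts at or below \<open>(\<gamma>/m) F(t\<^sub>0)\<close>. Hence \<open>F' + (\<gamma>/m) F \<le> (\<gamma>/m) F(t\<^sub>0)\<close> from then on, and
  integrating with the factor \<open>exp(\<gamma> t / m)\<close> yields \<open>F \<le> F(t\<^sub>0)\<close>.

  Two points need care. The gradient is only Lipschitz along the trajectory, so \<open>F'\<close> need not be
  differentiable; \<open>energy_nonincreasing\<close> bounds the upper right Dini derivative of \<open>E\<close> instead.
  And \<open>v\<close> is given only after \<open>t\<^sub>0\<close>, while the initial velocity is a right derivative of \<open>u\<close>; that the
  former converges to the latter is \<open>velocity_tendsto_initial_velocity\<close>.
\<close>

section \<open>Mean value arguments on the line\<close>

lemma tendsto_difference_quotient_if_has_vector_derivative:
  fixes \<phi> :: "real \<Rightarrow> 'a::real_normed_vector"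
  assumes "(\<phi> has_vector_derivative D) (at s within I)"
  shows "((\<lambda>t. (\<phi> t - \<phi> s) /\<^sub>R (t - s)) \<longlongrightarrow> D) (at s within I)"
proof (rule LIM_zero_cancel, rule tendsto_norm_zero_cancel)
  let ?r = "\<lambda>t. norm (\<phi> t - \<phi> s - (t - s) *\<^sub>R D) / norm (t - s)"
  have lim: "(?r \<longlongrightarrow> 0) (at s within I)"
    using assms by (simp add: has_vector_derivative_def has_derivative_iff_norm)
  have "?r t = norm ((\<phi> t - \<phi> s) /\<^sub>R (t - s) - D)" if "t \<noteq> s" for t
  proof -
    have "(\<phi> t - \<phi> s) /\<^sub>R (t - s) - D = (\<phi> t - \<phi> s - (t - s) *\<^sub>R D) /\<^sub>R (t - s)"
      using that by (simp add: scaleR_diff_right)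
    then show ?thesis by (simp add: divide_inverse mult.commute)
  qed
  then show "((\<lambda>t. norm ((\<phi> t - \<phi> s) /\<^sub>R (t - s) - D)) \<longlongrightarrow> 0) (at s within I)"
    using Lim_transform_within[OF lim zero_less_one] by auto
qed

lemma norm_diff_le_of_vector_derivative_bound:
  fixes \<phi> :: "real \<Rightarrow> 'a::real_normed_vector"
  assumes "convex I"
    and "\<And>t. t \<in> I \<Longrightarrow> (\<phi> has_vector_derivative \<phi>' t) (at t)"
    and "\<And>t. t \<in> I \<Longrightarrow> norm (\<phi>' t) \<le> K"
    and "t \<in> I" "s \<in> I"
  shows "norm (\<phi> t - \<phi> s) \<le> K * \<bar>t - s\<bar>"
proof -
  have "norm (\<phi> t - \<phi> s) \<le> K * norm (t - s)"
  proof (rule differentiable_bound[OF assms(1)])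
    show "(\<phi> has_derivative (\<lambda>h. h *\<^sub>R \<phi>' x)) (at x within I)" if "x \<in> I" for x
      using assms(2)[OF that] has_derivative_at_withinI
      unfolding has_vector_derivative_def by blast
    show "onorm (\<lambda>h. h *\<^sub>R \<phi>' x) \<le> K" if "x \<in> I" for x
      by (rule onorm_le) (use assms(3)[OF that] in \<open>simp add: mult.commute[of K] mult_left_mono\<close>)
  qed (use assms in auto)
  then show ?thesis by simp
qed

text \<open>
  At the last time at which \<open>H\<close> is below a line of small positive slope through \<open>(a, H a)\<close>, the
  Dini bound would keep \<open>H\<close> below that line a little longer.
\<close>

lemma nonincreasing_if_upper_right_Dini_nonpos:
  fixes H :: "real \<Rightarrow> real"
  assumes "a \<le> b" and cont: "continuous_on {a..b} H"
    and dini: "\<And>s e. \<lbrakk>a \<le> s; s < b; e > 0\<rbrakk> \<Longrightarrow>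
      eventually (\<lambda>t. H t - H s \<le> e * (t - s)) (at_right s)"
  shows "H b \<le> H a"
proof (rule ccontr)
  assume "\<not> H b \<le> H a"
  then have ab: "a < b" and gap: "H a < H b" using assms(1) by (auto simp: less_le)
  \<comment> \<open>half the slope of the chord, so that \<open>H b\<close> still lies above the line\<close>
  define e where "e = (H b - H a) / (2 * (b - a))"
  have e: "e > 0" using ab gap by (simp add: e_def)
  define \<phi> where "\<phi> t = H t - H a - e * (t - a)" for t
  have "e * (b - a) = (H b - H a) / 2"
    using ab unfolding e_def by (simp add: divide_simps)
  then have \<phi>b: "\<phi> b > 0" using gap by (simp add: \<phi>_def)
  have cont\<phi>: "continuous_on {a..b} \<phi>"
    unfolding \<phi>_def by (intro continuous_intros cont)
  define Z where "Z = {t \<in> {a..b}. \<phi> t \<le> 0}"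
  have "closed Z" unfolding Z_def
    using continuous_closed_preimage[OF cont\<phi>, of "{..0}"]
    by (simp add: vimage_def Int_def)
  moreover have "bounded Z" unfolding Z_def by (rule bounded_subset[of "{a..b}"]) auto
  ultimately have "compact Z" by (simp add: compact_eq_bounded_closed)
  moreover have "Z \<noteq> {}" using ab by (auto simp: Z_def \<phi>_def intro!: exI[of _ a])
  ultimately obtain c where c: "c \<in> Z" "\<And>t. t \<in> Z \<Longrightarrow> t \<le> c"
    using compact_attains_sup by metis
  have cab: "a \<le> c" "c < b" "\<phi> c \<le> 0"
    using c(1) \<phi>b by (auto simp: Z_def less_le)
  have "eventually (\<lambda>t. H t - H c \<le> e * (t - c)) (at_right c)"
    using dini cab e by blast
  moreover have "eventually (\<lambda>t. t < b \<and> c < t) (at_right c)"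
    using cab(2) by (auto simp: eventually_at_right)
  ultimately have "eventually (\<lambda>t. H t - H c \<le> e * (t - c) \<and> t < b \<and> c < t) (at_right c)"
    by eventually_elim auto
  then obtain t where t: "H t - H c \<le> e * (t - c)" "t < b" "c < t"
    using eventually_happens'[OF trivial_limit_at_right_real] by blast
  have "\<phi> t \<le> \<phi> c" using t(1) by (simp add: \<phi>_def algebra_simps)
  then have "t \<in> Z" using t cab by (auto simp: Z_def)
  with c(2) t(3) show False by fastforce
qed

lemma below_initial_if_damped_derivative_le:
  fixes F :: "real \<Rightarrow> real"
  assumes "a \<le> b" and cont: "continuous_on {a..b} F"
    and der: "\<And>t. t \<in> {a<..<b} \<Longrightarrow> (F has_real_derivative g t) (at t)"
    and le: "\<And>t. t \<in> {a<..<b} \<Longrightarrow> g t + k * F t \<le> k * F a"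
  shows "F b \<le> F a"
proof -
  define P where "P t = exp (k * t) * (F t - F a)" for t
  have "P b \<le> P a"
  proof (rule DERIV_nonpos_imp_decreasing_open[OF assms(1)])
    show "continuous_on {a..b} P"
      unfolding P_def by (intro continuous_intros cont)
    fix t assume "a < t" "t < b"
    then have t: "t \<in> {a<..<b}" by simp
    have "(P has_real_derivative exp (k * t) * (g t + k * F t - k * F a)) (at t)"
      unfolding P_def by (auto intro!: derivative_eq_intros der[OF t] simp: algebra_simps)
    moreover have "exp (k * t) * (g t + k * F t - k * F a) \<le> 0"
      using le[OF t] by (simp add: mult_le_0_iff)
    ultimately show "\<exists>y. (P has_real_derivative y) (at t) \<and> y \<le> 0" by blast
  qed
  then show ?thesis by (simp add: P_def mult_le_0_iff)
qed

section \<open>Attainment of the initial velocity\<close>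

text \<open>
  The equation controls \<open>v\<close> near \<open>t0\<close> even though \<open>v\<close> is not assumed bounded there:
  \<open>m v + \<gamma> u\<close> has the bounded derivative \<open>S\<close>, so \<open>v\<close> is bounded, hence so is \<open>a\<close>, and \<open>v\<close> is
  Lipschitz. A Lipschitz derivative differs from the difference quotient based at \<open>t0\<close> by a multiple
  of \<open>t - t0\<close>, and that quotient tends to \<open>w0\<close>.
\<close>

lemma velocity_tendsto_initial_velocity:
  fixes u v a S :: "real \<Rightarrow> 'a::real_normed_vector"
  assumes m: "m > 0" and tb: "t0 < b" and cont: "continuous_on {t0..b} u"
    and du: "\<And>t. t \<in> {t0<..<b} \<Longrightarrow> (u has_vector_derivative v t) (at t)"
    and dv: "\<And>t. t \<in> {t0<..<b} \<Longrightarrow> (v has_vector_derivative a t) (at t)"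
    and ode: "\<And>t. t \<in> {t0<..<b} \<Longrightarrow> m *\<^sub>R a t = - (\<gamma> *\<^sub>R v t) + S t"
    and S: "\<And>t. t \<in> {t0<..<b} \<Longrightarrow> norm (S t) \<le> B"
    and w0: "(u has_vector_derivative w0) (at_right t0)"
  shows "(v \<longlongrightarrow> w0) (at_right t0)"
proof -
  let ?I = "{t0<..<b}"
  define c where "c = (t0 + b) / 2"
  have c: "c \<in> ?I" using tb by (simp add: c_def)
  have B: "B \<ge> 0" using S[OF c] norm_ge_zero order_trans by blast
  define z where "z t = m *\<^sub>R v t + \<gamma> *\<^sub>R u t" for t
  have dz: "(z has_vector_derivative S t) (at t)" if "t \<in> ?I" for t
    unfolding z_def
    by (rule has_vector_derivative_eq_rhs, rule has_vector_derivative_add,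
        (rule bounded_linear.has_vector_derivative[OF bounded_linear_scaleR_right]
           du[OF that] dv[OF that])+)
       (use ode[OF that] in simp)
  have z_le: "norm (z t) \<le> norm (z c) + B * (b - t0)" if "t \<in> ?I" for t
  proof -
    have "norm (z t - z c) \<le> B * \<bar>t - c\<bar>"
      by (rule norm_diff_le_of_vector_derivative_bound[of ?I z S]) (use dz S that c in auto)
    also have "\<dots> \<le> B * (b - t0)" using that c B by (intro mult_left_mono) auto
    finally show ?thesis using norm_triangle_sub[of "z t" "z c"] by linarith
  qed
  have "bounded (u ` {t0..b})"
    by (intro compact_imp_bounded compact_continuous_image cont) simp
  then obtain U where U: "\<And>t. t \<in> ?I \<Longrightarrow> norm (u t) \<le> U"
    unfolding bounded_iff by force
  define V where "V = (norm (z c) + B * (b - t0) + \<bar>\<gamma>\<bar> * U) / m"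
  have V: "norm (v t) \<le> V" if "t \<in> ?I" for t
  proof -
    have "m * norm (v t) = norm (z t - \<gamma> *\<^sub>R u t)" using m by (simp add: z_def)
    also have "\<dots> \<le> norm (z t) + \<bar>\<gamma>\<bar> * norm (u t)"
      by (metis norm_triangle_ineq4 norm_scaleR)
    also have "\<dots> \<le> norm (z c) + B * (b - t0) + \<bar>\<gamma>\<bar> * U"
      by (intro add_mono z_le[OF that] mult_left_mono U[OF that]) simp
    finally show ?thesis using m by (simp add: V_def field_simps)
  qed
  define K where "K = (\<bar>\<gamma>\<bar> * V + B) / m"
  have A: "norm (a t) \<le> K" if "t \<in> ?I" for t
  proof -
    have "m * norm (a t) = norm (- (\<gamma> *\<^sub>R v t) + S t)"
      using ode[OF that] m by (metis norm_scaleR abs_of_pos)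
    also have "\<dots> \<le> \<bar>\<gamma>\<bar> * norm (v t) + norm (S t)"
      by (metis norm_triangle_ineq norm_minus_cancel norm_scaleR)
    also have "\<dots> \<le> \<bar>\<gamma>\<bar> * V + B"
      by (intro add_mono S[OF that] mult_left_mono V[OF that]) simp
    finally show ?thesis using m by (simp add: K_def field_simps)
  qed
  have K: "K \<ge> 0" using A[OF c] norm_ge_zero order_trans by blast
  have quot: "norm ((u t - u t0) /\<^sub>R (t - t0) - v t) \<le> K * (t - t0)" if t: "t \<in> ?I" for t
  proof -
    \<comment> \<open>differentiability is known only after \<open>t0\<close>: estimate from \<open>s\<close>, then let \<open>s\<close> tend to \<open>t0\<close>\<close>
    have lin: "norm (u t - u s - (t - s) *\<^sub>R v t) \<le> K * (t - t0) * (t - t0)"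
      if s: "t0 < s" "s < t" for s
    proof -
      let ?p = "\<lambda>r. u r - r *\<^sub>R v t"
      have "norm (?p t - ?p s) \<le> K * (t - t0) * \<bar>t - s\<bar>"
      proof (rule norm_diff_le_of_vector_derivative_bound[of "{t0<..t}" ?p "\<lambda>r. v r - v t"])
        show "(?p has_vector_derivative v r - v t) (at r)" if "r \<in> {t0<..t}" for r
          using that t by (auto intro!: derivative_eq_intros du)
        show "norm (v r - v t) \<le> K * (t - t0)" if "r \<in> {t0<..t}" for r
        proof -
          have "norm (v r - v t) \<le> K * \<bar>r - t\<bar>"
            by (rule norm_diff_le_of_vector_derivative_bound[of ?I v a]) (use dv A that t in auto)
          also have "\<dots> \<le> K * (t - t0)" using that K by (intro mult_left_mono) auto
          finally show ?thesis .
        qed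
      qed (use s in auto)
      also have "\<dots> \<le> K * (t - t0) * (t - t0)" using s K by (intro mult_left_mono) auto
      finally show ?thesis by (simp add: algebra_simps)
    qed
    have ut0: "(u \<longlongrightarrow> u t0) (at_right t0)"
      using cont tb by (rule continuous_on_Icc_at_rightD)
    have "((\<lambda>s. norm (u t - u s - (t - s) *\<^sub>R v t)) \<longlongrightarrow>
        norm (u t - u t0 - (t - t0) *\<^sub>R v t)) (at_right t0)"
      by (intro tendsto_intros ut0)
    moreover have "eventually (\<lambda>s. norm (u t - u s - (t - s) *\<^sub>R v t) \<le> K * (t - t0) * (t - t0))
        (at_right t0)"
      by (rule eventually_mono[OF eventually_at_right_real[of t0 t]]) (use t lin in auto)
    ultimately have *: "norm (u t - u t0 - (t - t0) *\<^sub>R v t) \<le> K * (t - t0) * (t - t0)"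
      by (rule tendsto_upperbound) simp
    have "(u t - u t0) /\<^sub>R (t - t0) - v t = (u t - u t0 - (t - t0) *\<^sub>R v t) /\<^sub>R (t - t0)"
      using t by (simp add: scaleR_diff_right)
    then have "norm ((u t - u t0) /\<^sub>R (t - t0) - v t) =
        norm (u t - u t0 - (t - t0) *\<^sub>R v t) / (t - t0)"
      using t by (simp add: divide_inverse mult.commute)
    then show ?thesis using * t by (simp add: divide_le_eq)
  qed
  have q: "((\<lambda>t. (u t - u t0) /\<^sub>R (t - t0)) \<longlongrightarrow> w0) (at_right t0)"
    using w0 by (rule tendsto_difference_quotient_if_has_vector_derivative)
  have "((\<lambda>t. (u t - u t0) /\<^sub>R (t - t0) - v t) \<longlongrightarrow> 0) (at_right t0)"
  proof (rule Lim_null_comparison)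
    show "eventually (\<lambda>t. norm ((u t - u t0) /\<^sub>R (t - t0) - v t) \<le> K * (t - t0)) (at_right t0)"
      by (rule eventually_mono[OF eventually_at_right_real[OF tb]]) (rule quot)
    show "((\<lambda>t. K * (t - t0)) \<longlongrightarrow> 0) (at_right t0)"
      by (rule tendsto_eq_intros | simp)+
  qed
  from tendsto_diff[OF q this] show ?thesis by simp
qed

section \<open>The energy along a trajectory\<close>

lemma continuous_on_cont_diff:
  assumes "cont_diff f"
  shows "continuous_on UNIV f"
  using assms
  by (simp add: cont_diff_def continuous_on_eq_continuous_within
      differentiable_imp_continuous_within)

lemma DERIV_along_curve:
  fixes f :: "'a::{real_inner, complete_space} \<Rightarrow> real"
  assumes f: "cont_diff f" and u: "(u has_vector_derivative v) (at t)"
  shows "((\<lambda>t. f (u t)) has_real_derivative inner (grad f (u t)) v) (at t)"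
proof -
  have "(f has_derivative (\<lambda>h. inner h (grad f (u t)))) (at (u t))"
    using GDERIV_grad[of f "u t"] f by (simp add: cont_diff_def gderiv_def)
  from has_derivative_compose[OF u[unfolded has_vector_derivative_def] this]
  show ?thesis
    unfolding has_field_derivative_def
    by (rule has_derivative_eq_rhs) (simp add: fun_eq_iff inner_commute)
qed

text \<open>
  In the product rule for \<open>\<langle>G, v\<rangle>\<close>, the missing derivative of \<open>G\<close> enters only through
  \<open>\<langle>G t - G s, v t\<rangle>\<close>. By Cauchy-Schwarz and the Lipschitz bound, this increment divided by \<open>t - s\<close> is
  at most a quantity tending to \<open>L \<parallel>v s\<parallel>\<^sup>2\<close>.
\<close>

lemma upper_right_Dini_inner_add:
  fixes G u v :: "real \<Rightarrow> 'a::real_inner" and R :: "real \<Rightarrow> real"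
  assumes G: "eventually (\<lambda>t. norm (G t - G s) \<le> L * norm (u t - u s)) (at_right s)"
    and du: "(u has_vector_derivative v s) (at s)"
    and dv: "(v has_vector_derivative a) (at s)"
    and dR: "(R has_real_derivative r) (at s)"
    and neg: "L * (norm (v s))\<^sup>2 + inner (G s) a + r \<le> 0"
    and e: "e > 0"
  shows "eventually (\<lambda>t. (inner (G t) (v t) + R t) - (inner (G s) (v s) + R s) \<le> e * (t - s))
    (at_right s)"
proof -
  \<comment> \<open>an upper bound for the difference quotient that converges as \<open>t\<close> tends to \<open>s\<close>\<close>
  define Q where "Q t = L * (norm ((u t - u s) /\<^sub>R (t - s)) * norm (v t))
      + inner (G s) ((v t - v s) /\<^sub>R (t - s)) + (R t - R s) / (t - s)" for t
  have qu: "((\<lambda>t. (u t - u s) /\<^sub>R (t - s)) \<longlongrightarrow> v s) (at_right s)"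
    using has_vector_derivative_at_within[OF du]
    by (rule tendsto_difference_quotient_if_has_vector_derivative)
  have qv: "((\<lambda>t. (v t - v s) /\<^sub>R (t - s)) \<longlongrightarrow> a) (at_right s)"
    using has_vector_derivative_at_within[OF dv]
    by (rule tendsto_difference_quotient_if_has_vector_derivative)
  have qR: "((\<lambda>t. (R t - R s) / (t - s)) \<longlongrightarrow> r) (at_right s)"
    using has_field_derivative_at_within[OF dR] by (simp add: has_field_derivative_iff)
  have "isCont v s" using dv by (rule has_vector_derivative_continuous)
  then have vs: "(v \<longlongrightarrow> v s) (at_right s)"
    by (simp add: isCont_def filterlim_at_split)
  have "(Q \<longlongrightarrow> L * (norm (v s) * norm (v s)) + inner (G s) a + r) (at_right s)"
    unfolding Q_def by (intro tendsto_intros qu qv qR vs)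
  moreover have "L * (norm (v s) * norm (v s)) + inner (G s) a + r < e"
    using neg e by (simp add: power2_eq_square)
  ultimately have "eventually (\<lambda>t. Q t < e) (at_right s)" by (rule order_tendstoD)
  moreover have "eventually (\<lambda>t. s < t) (at_right s)" by (rule eventually_at_right_less)
  ultimately show ?thesis using G
  proof eventually_elim
    case (elim t)
    have "inner (G t - G s) (v t) \<le> norm (G t - G s) * norm (v t)"
      by (rule norm_cauchy_schwarz)
    also have "\<dots> \<le> L * norm (u t - u s) * norm (v t)"
      using elim by (intro mult_right_mono) auto
    finally have "inner (G t) (v t) + R t - (inner (G s) (v s) + R s)
        \<le> L * norm (u t - u s) * norm (v t) + inner (G s) (v t - v s) + (R t - R s)"
      by (simp add: inner_diff)
    also have "\<dots> = Q t * (t - s)"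
    proof -
      have "norm ((u t - u s) /\<^sub>R (t - s)) * (t - s) = norm (u t - u s)"
        "inner (G s) ((v t - v s) /\<^sub>R (t - s)) * (t - s) = inner (G s) (v t - v s)"
        "(R t - R s) / (t - s) * (t - s) = R t - R s"
        using elim by simp_all
      moreover have "(L * (x * n) + y + z) * d = L * (x * d) * n + y * d + z * d" for x y z n d
        by (simp add: algebra_simps)
      ultimately show ?thesis by (simp only: Q_def)
    qed
    also have "\<dots> \<le> e * (t - s)" using elim by (intro mult_right_mono) auto
    finally show ?case .
  qed
qed

text \<open>
  The descent inequality bounds \<open>\<langle>\<nabla>f(u), m a + \<gamma> v\<rangle>\<close> by \<open>- \<parallel>m a + \<gamma> v\<parallel>\<^sup>2\<close>. The term
  \<open>\<gamma> \<parallel>v\<parallel>\<^sup>2\<close> of the energy is chosen so that its derivative cancels the cross term of this square;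
  what remains of the square, \<open>- \<gamma>\<^sup>2 \<parallel>v\<parallel>\<^sup>2\<close>, absorbs the Lipschitz error \<open>m L \<parallel>v\<parallel>\<^sup>2\<close>.
\<close>

lemma energy_nonincreasing:
  fixes f :: "'a::{real_inner, complete_space} \<Rightarrow> real" and u v a :: "real \<Rightarrow> 'a"
  assumes f: "cont_diff f" and m: "m > 0" and mL: "m * L \<le> \<gamma>\<^sup>2"
    and lip: "\<And>s t. \<lbrakk>s \<in> {c..d}; t \<in> {c..d}\<rbrakk> \<Longrightarrow>
        norm (grad f (u t) - grad f (u s)) \<le> L * norm (u t - u s)"
    and du: "\<And>t. t \<in> {c..d} \<Longrightarrow> (u has_vector_derivative v t) (at t)"
    and dv: "\<And>t. t \<in> {c..d} \<Longrightarrow> (v has_vector_derivative a t) (at t)"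
    and descent: "\<And>t. t \<in> {c..d} \<Longrightarrow>
        inner (grad f (u t)) (m *\<^sub>R a t + \<gamma> *\<^sub>R v t) \<le> - (norm (m *\<^sub>R a t + \<gamma> *\<^sub>R v t))\<^sup>2"
    and cd: "c \<le> d"
  defines "E \<equiv> \<lambda>t. inner (grad f (u t)) (v t) + ((\<gamma> / m) * f (u t) + \<gamma> * inner (v t) (v t))"
  shows "E d \<le> E c"
proof (rule nonincreasing_if_upper_right_Dini_nonpos[OF cd])
  have fc: "continuous_on UNIV f" and gc: "continuous_on UNIV (grad f)"
    using f continuous_on_cont_diff by (auto simp: cont_diff_def)
  have uc: "continuous_on {c..d} u"
    by (rule continuous_at_imp_continuous_on) (blast intro: has_vector_derivative_continuous du)
  have vc: "continuous_on {c..d} v"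
    by (rule continuous_at_imp_continuous_on) (blast intro: has_vector_derivative_continuous dv)
  show "continuous_on {c..d} E"
    unfolding E_def
    by (intro continuous_intros vc continuous_on_compose2[OF gc uc] continuous_on_compose2[OF fc uc])
      auto
  fix s e :: real assume s: "c \<le> s" "s < d" and e: "e > 0"
  then have sI: "s \<in> {c..d}" by simp
  have F': "((\<lambda>t. f (u t)) has_real_derivative inner (grad f (u s)) (v s)) (at s)"
    using f du[OF sI] by (rule DERIV_along_curve)
  have N': "((\<lambda>t. inner (v t) (v t)) has_real_derivative 2 * inner (v s) (a s)) (at s)"
    unfolding has_field_derivative_def
    by (rule has_derivative_eq_rhs, rule has_derivative_inner,
        (rule dv[OF sI, unfolded has_vector_derivative_def])+) (auto simp: inner_commute)
  show "eventually (\<lambda>t. E t - E s \<le> e * (t - s)) (at_right s)"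
    unfolding E_def
  proof (rule upper_right_Dini_inner_add[OF _ du[OF sI] dv[OF sI] _ _ e])
    show "eventually (\<lambda>t. norm (grad f (u t) - grad f (u s)) \<le> L * norm (u t - u s)) (at_right s)"
      by (rule eventually_mono[OF eventually_at_right_real[OF s(2)]]) (use s lip[OF sI] in auto)
    show "((\<lambda>t. (\<gamma> / m) * f (u t) + \<gamma> * inner (v t) (v t)) has_real_derivative
        (\<gamma> / m) * inner (grad f (u s)) (v s) + \<gamma> * (2 * inner (v s) (a s))) (at s)"
      by (intro DERIV_add DERIV_cmult F' N')
    let ?D = "L * (norm (v s))\<^sup>2 + inner (grad f (u s)) (a s)
        + ((\<gamma> / m) * inner (grad f (u s)) (v s) + \<gamma> * (2 * inner (v s) (a s)))"
    have "(norm (m *\<^sub>R a s + \<gamma> *\<^sub>R v s))\<^sup>2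
        = m\<^sup>2 * (norm (a s))\<^sup>2 + \<gamma>\<^sup>2 * (norm (v s))\<^sup>2 + 2 * m * \<gamma> * inner (v s) (a s)"
      unfolding power2_norm_eq_inner
      by (simp add: inner_add inner_commute power2_eq_square algebra_simps)
    moreover have "m * ?D = m * L * (norm (v s))\<^sup>2
        + inner (grad f (u s)) (m *\<^sub>R a s + \<gamma> *\<^sub>R v s) + 2 * m * \<gamma> * inner (v s) (a s)"
      using m by (simp add: inner_add_right field_simps)
    moreover have "m * L * (norm (v s))\<^sup>2 \<le> \<gamma>\<^sup>2 * (norm (v s))\<^sup>2"
      using mL by (intro mult_right_mono) auto
    moreover have "0 \<le> m\<^sup>2 * (norm (a s))\<^sup>2" by simp
    ultimately have "m * ?D \<le> 0" using descent[OF sI] by linarith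
    then show "?D \<le> 0" using m by (simp add: mult_le_0_iff)
  qed
qed

section \<open>The steepest descent field and the Lipschitz constant\<close>

text \<open>
  The variational inequality for the projection \<open>- steepest q f x\<close> of \<open>0\<close> onto the hull, tested
  with the vertex \<open>grad (f i) x\<close>.
\<close>

lemma inner_grad_steepest_le:
  fixes f :: "nat \<Rightarrow> 'a::real_inner \<Rightarrow> real"
  assumes q: "q \<ge> 1" and i: "i \<in> {1..q}"
  shows "inner (grad (f i) x) (steepest q f x) \<le> - (norm (steepest q f x))\<^sup>2"
proof -
  let ?C = "grad_hull q f x" and ?s = "steepest q f x"
  have C: "convex ?C" "closed ?C"
    by (auto simp: grad_hull_def intro: compact_imp_closed finite_imp_compact_convex_hull)
  have g: "grad (f i) x \<in> ?C"
    unfolding grad_hull_def using i by (intro hull_inc) auto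
  have "inner (0 - (- ?s)) (grad (f i) x - (- ?s)) \<le> 0"
    by (rule any_closest_point_dot[OF C steepest_well_defined(1)[OF q] g])
      (use steepest_well_defined(2)[OF q] in auto)
  then show ?thesis
    by (simp add: inner_add power2_norm_eq_inner inner_commute)
qed

lemma norm_diff_le_Lip:
  assumes fin: "Lip \<phi> A < \<infinity>" and "x \<in> A" "y \<in> A"
  shows "norm (\<phi> x - \<phi> y) \<le> enn2real (Lip \<phi> A) * norm (x - y)"
proof (cases "x = y")
  case False
  have "ennreal (norm (\<phi> x - \<phi> y) / norm (x - y)) \<le> Lip \<phi> A"
    unfolding Lip_def by (rule SUP_upper2[of "(x, y)"]) (use assms False in auto)
  then have "norm (\<phi> x - \<phi> y) / norm (x - y) \<le> enn2real (Lip \<phi> A)"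
    using enn2real_mono[of "ennreal (norm (\<phi> x - \<phi> y) / norm (x - y))" "Lip \<phi> A"] fin
    by simp
  then show ?thesis using False by (simp add: divide_le_eq)
qed simp

section \<open>Descent of a single objective\<close>

text \<open>
  The energy bound is transported to the open interval from the limit at \<open>t0\<close>, where the condition on
  \<open>w0\<close> makes the sum of the two velocity terms nonpositive. The remaining differential inequality for
  \<open>f i \<circ> u\<close> is integrated.
\<close>

lemma objective_le_initial:
  fixes f :: "nat \<Rightarrow> 'a::{real_inner, complete_space} \<Rightarrow> real"
  assumes q: "q \<ge> 1" and m: "m > 0" and \<gamma>: "\<gamma> > 0"
    and f: "cont_diff (f i)" and i: "i \<in> {1..q}"
    and sol: "IMOG_solution m \<gamma> q f t0 T u0 w0 u"
    and L: "ennreal m * Lip (grad (f i)) (u ` time_dom t0 T) \<le> ennreal (\<gamma>\<^sup>2)"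
    and init: "inner (grad (f i) u0) w0 \<le> - \<gamma> * (norm w0)\<^sup>2"
    and b: "b \<in> time_dom t0 T"
  shows "f i (u b) \<le> f i u0"
proof (cases "b = t0")
  case True
  then show ?thesis using sol by (simp add: IMOG_solution_def)
next
  case False
  with b have tb: "t0 < b" by (simp add: time_dom_def)
  let ?D = "time_dom t0 T" and ?G = "\<lambda>t. grad (f i) (u t)"
  have sub: "{t0..b} \<subseteq> ?D"
    using b by (auto simp: time_dom_def intro: le_less_trans[of "ereal _" "ereal b"])
  then have subo: "t \<in> ?D - {t0}" if "t \<in> {t0<..<b}" for t using that by auto
  obtain v a where
    du: "\<And>t. t \<in> {t0<..<b} \<Longrightarrow> (u has_vector_derivative v t) (at t)" and
    dv: "\<And>t. t \<in> {t0<..<b} \<Longrightarrow> (v has_vector_derivative a t) (at t)" and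
    ode: "\<And>t. t \<in> {t0<..<b} \<Longrightarrow> m *\<^sub>R a t = - (\<gamma> *\<^sub>R v t) + steepest q f (u t)" and
    cont: "continuous_on ?D u" and ut0: "u t0 = u0" and
    w0: "(u has_vector_derivative w0) (at_right t0)"
    using sol subo unfolding IMOG_solution_def by metis
  have uc: "continuous_on {t0..b} u" using cont sub by (rule continuous_on_subset)
  have fc: "continuous_on UNIV (f i)" using f by (rule continuous_on_cont_diff)
  have Gc: "continuous_on {t0..b} ?G"
    using f by (intro continuous_on_compose2[OF _ uc]) (auto simp: cont_diff_def)
  have Fc: "continuous_on {t0..b} (\<lambda>t. f i (u t))"
    by (rule continuous_on_compose2[OF fc uc]) simp

  have "bounded (?G ` {t0..b})"
    by (intro compact_imp_bounded compact_continuous_image Gc) simp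
  then obtain B where B: "\<And>t. t \<in> {t0<..<b} \<Longrightarrow> norm (?G t) \<le> B"
    unfolding bounded_iff by force
  \<comment> \<open>minimality of the norm bounds the field along the trajectory by the continuous \<open>?G\<close>\<close>
  have "norm (steepest q f x) \<le> norm (grad (f i) x)" for x
    using i by (intro steepest_well_defined(2)[OF q]) (auto simp: grad_hull_def intro: hull_inc)
  then have "norm (steepest q f (u t)) \<le> B" if "t \<in> {t0<..<b}" for t
    using B[OF that] order_trans by blast
  then have v0: "(v \<longlongrightarrow> w0) (at_right t0)"
    using velocity_tendsto_initial_velocity[OF m tb uc du dv ode _ w0] by blast

  define L where "L = enn2real (Lip (grad (f i)) (u ` ?D))"
  have fin: "Lip (grad (f i)) (u ` ?D) < \<infinity>"
  proof (rule ccontr)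
    assume "\<not> ?thesis"
    then have "Lip (grad (f i)) (u ` ?D) = top"
      by (metis infinity_ennreal_def less_top)
    then show False using L m by (simp add: ennreal_mult_top top_unique)
  qed
  then have "Lip (grad (f i)) (u ` ?D) = ennreal L" by (simp add: L_def)
  then have "ennreal (m * L) \<le> ennreal (\<gamma>\<^sup>2)"
    using L m by (metis ennreal_mult' less_imp_le)
  then have mL: "m * L \<le> \<gamma>\<^sup>2" by (subst (asm) ennreal_le_iff) auto

  define E where
    "E t = inner (?G t) (v t) + ((\<gamma> / m) * f i (u t) + \<gamma> * inner (v t) (v t))" for t
  have lip: "norm (?G t - ?G s) \<le> L * norm (u t - u s)" if "s \<in> {t0..b}" "t \<in> {t0..b}" for s t
    unfolding L_def using norm_diff_le_Lip[OF fin, of "u t" "u s"] that sub by blast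
  have descent: "inner (?G t) (m *\<^sub>R a t + \<gamma> *\<^sub>R v t) \<le> - (norm (m *\<^sub>R a t + \<gamma> *\<^sub>R v t))\<^sup>2"
    if "t \<in> {t0<..<b}" for t
    using inner_grad_steepest_le[OF q i, of f "u t"] ode[OF that] by simp
  have mono: "E d \<le> E c" if "t0 < c" "c \<le> d" "d < b" for c d
  proof -
    have "t \<in> {t0<..<b}" "t \<in> {t0..b}" if "t \<in> {c..d}" for t
      using that \<open>t0 < c\<close> \<open>d < b\<close> by auto
    then show ?thesis
      unfolding E_def using \<open>c \<le> d\<close>
      by (intro energy_nonincreasing[OF f m mL, where u = u and v = v and a = a]
          lip du dv descent)
  qed
  have E_lim: "(E \<longlongrightarrow> inner (?G t0) w0 + ((\<gamma> / m) * f i (u t0) + \<gamma> * inner w0 w0)) (at_right t0)"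
    unfolding E_def by (intro tendsto_intros v0
      continuous_on_Icc_at_rightD[OF Gc tb] continuous_on_Icc_at_rightD[OF Fc tb])
  have E_le: "E t \<le> (\<gamma> / m) * f i u0" if "t \<in> {t0<..<b}" for t
  proof -
    have "eventually (\<lambda>c. E t \<le> E c) (at_right t0)"
      by (rule eventually_mono[OF eventually_at_right_real[of t0 t]]) (use that mono in auto)
    from tendsto_lowerbound[OF E_lim this]
    have "E t \<le> inner (?G t0) w0 + ((\<gamma> / m) * f i (u t0) + \<gamma> * inner w0 w0)" by simp
    then show ?thesis using init by (simp add: ut0 power2_norm_eq_inner)
  qed

  have "f i (u b) \<le> f i (u t0)"
  proof (rule below_initial_if_damped_derivative_le[OF less_imp_le[OF tb] Fc])
    fix t assume t: "t \<in> {t0<..<b}"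
    show "((\<lambda>t. f i (u t)) has_real_derivative inner (?G t) (v t)) (at t)"
      using f du[OF t] by (rule DERIV_along_curve)
    have "0 \<le> \<gamma> * inner (v t) (v t)" using \<gamma> by simp
    then show "inner (?G t) (v t) + (\<gamma> / m) * f i (u t) \<le> (\<gamma> / m) * f i (u t0)"
      using E_le[OF t] by (simp add: E_def ut0)
  qed
  then show ?thesis by (simp add: ut0)
qed

lemma scaled_steepest_initial_velocity:
  fixes f :: "nat \<Rightarrow> 'a::real_inner \<Rightarrow> real"
  assumes "q \<ge> 1" "\<gamma> > 0" "i \<in> {1..q}" and c: "c \<in> {0..1/\<gamma>}"
  shows "inner (grad (f i) x) (c *\<^sub>R steepest q f x) \<le> - \<gamma> * (norm (c *\<^sub>R steepest q f x))\<^sup>2"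
proof -
  let ?s = "steepest q f x"
  have c: "0 \<le> c" "c * \<gamma> \<le> 1" using c \<open>\<gamma> > 0\<close> by (auto simp: field_simps)
  have "inner (grad (f i) x) (c *\<^sub>R ?s) \<le> c * - (norm ?s)\<^sup>2"
    using mult_left_mono[OF inner_grad_steepest_le[OF assms(1,3)] c(1)] by simp
  also have "\<dots> \<le> c * - ((c * \<gamma>) * (norm ?s)\<^sup>2)"
    using c by (intro mult_left_mono) (auto simp: mult_left_le_one_le \<open>\<gamma> > 0\<close> less_imp_le)
  also have "\<dots> = - \<gamma> * (norm (c *\<^sub>R ?s))\<^sup>2"
    by (simp add: power_mult_distrib power2_eq_square)
  finally show ?thesis .
qed

theorem corollary4p5:
  fixes f :: "nat \<Rightarrow> 'a::{real_inner, complete_space} \<Rightarrow> real"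
    and q i :: nat and m \<gamma> :: real and u0 :: 'a
  assumes "q \<ge> 1" and "m > 0" and "\<gamma> > 0"
    and "\<And>j. j \<in> {1..q} \<Longrightarrow> cont_diff (f j)"
    and "\<And>j. j \<in> {1..q} \<Longrightarrow> lipschitz_on_bounded_sets (grad (f j))"
    and "i \<in> {1..q}"
  shows "(\<forall>t0 T w0 u.
            IMOG_solution m \<gamma> q f t0 T u0 w0 u \<longrightarrow>
            ennreal (\<gamma>\<^sup>2) > ennreal m * Lip (grad (f i)) (u ` time_dom t0 T) \<longrightarrow>
            inner (grad (f i) u0) w0 \<le> - \<gamma> * (norm w0)\<^sup>2 \<longrightarrow>
            (\<forall>t \<in> time_dom t0 T. f i (u t) \<le> f i u0)) \<and>
         (\<forall>c \<in> {0..1/\<gamma>}.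
            inner (grad (f i) u0) (c *\<^sub>R steepest q f u0)
              \<le> - \<gamma> * (norm (c *\<^sub>R steepest q f u0))\<^sup>2)"
proof (intro conjI allI impI ballI)
  fix t0 T w0 u t
  assume sol: "IMOG_solution m \<gamma> q f t0 T u0 w0 u"
    and L: "ennreal m * Lip (grad (f i)) (u ` time_dom t0 T) < ennreal (\<gamma>\<^sup>2)"
    and init: "inner (grad (f i) u0) w0 \<le> - \<gamma> * (norm w0)\<^sup>2" and t: "t \<in> time_dom t0 T"
  show "f i (u t) \<le> f i u0"
    by (rule objective_le_initial[OF assms(1-3) assms(4)[OF assms(6)] assms(6) sol
          less_imp_le[OF L] init t])
next
  fix c assume c: "c \<in> {0..1/\<gamma>}"
  show "inner (grad (f i) u0) (c *\<^sub>R steepest q f u0)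
      \<le> - \<gamma> * (norm (c *\<^sub>R steepest q f u0))\<^sup>2"
    by (rule scaled_steepest_initial_velocity[OF assms(1,3,6) c])
qed

end
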